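(* Let $\mathcal M=(M,\rho)$ be a pseudo-metric space consisting of $n$ points, and let $\varphi_{\mathcal M}:M\to\ell_\infty^n$ be the Kuratowski isometry. For any connected graph $G$ joining $M$ there exists a minimal parametric filling of type $G$ of the space $\mathcal M$. Each minimal parametric filling $\mathcal G=(G,\omega)$ of type $G$ of $\mathcal M$ is isometric to the corresponding Kuratowski network $\Gamma_{\mathcal G}$, which is in this case a minimal parametric network of type $G$ with the boundary $\varphi_{\mathcal M}$. Conversely, each minimal parametric network in $\ell_\infty^n$ of type $G$ with the boundary $\varphi_{\mathcal M}$ is isometric to some minimal parametric filling of type $G$ of the space $\mathcal M$.
   Context: In a pseudo-metric space the distance between distinct points may be $0$. A graph $G=(V,E)$ (finite) joins $M$ if it is connected and $M\subset V$; then $M$ is its boundary $\partial G$. For a weight function $\omega:E\to[0,\infty)$, $d_\omega(u,v)$ is the least weight (sum of $\omega$ over edges) of a path in $G$ joining $u$ and $v$, and $\omega(G)=\sum_{e\in E}\omega(e)$. The weighted graph $(G,\omega)$ is a filling of $\mathcal M=(M,\rho)$ of type $G$ if $G$ joins $M$ and $\rho(p,q)\le d_\omega(p,q)$ for all $p,q\in M$. A minimal parametric filling of type $G$ of $\mathcal M$ is a filling $(G,\omega)$ of $\mathcal M$ whose weight $\omega(G)$ is least among all fillings of $\mathcal M$ of the given type $G$. Networks. A network of type $G=(V,E)$ in a pseudo-metric space $(X,d)$ is a map $\Gamma:V\to X$; its length is $d(\Gamma)=\sum_{vw\in E}d(\Gamma(v),\Gamma(w))$; its boundary is the restriction $\Gamma|_{\partial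 G}$. For $\varphi:\partial G\to X$, a minimal parametric network of type $G$ with boundary $\varphi$ is a network $\Gamma$ of type $G$ with $\Gamma|_{\partial G}=\varphi$ having the least length among all such networks. The weight function induced by $\Gamma$ is $\omega_\Gamma(vw)=d(\Gamma(v),\Gamma(w))$. A network $\Gamma$ of type $G$ and a weighted graph $\mathcal H$ are isometric if the weighted graphs $\mathcal H$ and $(G,\omega_\Gamma)$ are isomorphic. Kuratowski isometry. $\ell_\infty^n$ is $\mathbb R^n$ with the norm $\|v\|_\infty=\max_i|v^i|$. If $M=\{p_1,\dots,p_n\}$, then $\varphi_{\mathcal M}(p_i)=(\rho(p_i,p_1),\dots,\rho(p_i,p_n))$. Kuratowski network. For a filling $\mathcal G=(G,\omega)$ of $\mathcal M$, let $\bar G$ be the multigraph with vertex set $V$ whose edge set is the disjoint union of $E$ and the edge set of the complete graph on $M$, with the weight function $\bar\omega$ equal to $\omega$ on $E$ and to $\rho(p_i,p_j)$ on the edge $p_ip_j$ of the complete graph. Let $d_{\bar\omega}$ be the corresponding pseudo-metric on $V$ (least weight of a path in $\bar G$). The Kuratowski network for $\mathcal G$ is $\Gamma_{\mathcal G}:V\to\ell_\infty^n$, $\Gamma_{\mathcal G}(v)=(d_{\bar\omega}(v,p_1),\dots,d_{\bar\omega}(v,p_n))$. *)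

theory Defs
  imports "HOL-Analysis.Analysis"
begin

definition pseudo_metric_on :: "'a set \<Rightarrow> ('a \<Rightarrow> 'a \<Rightarrow> real) \<Rightarrow> bool" where
  "pseudo_metric_on X d \<longleftrightarrow>
     (\<forall>x\<in>X. d x x = 0) \<and>
     (\<forall>x\<in>X. \<forall>y\<in>X. 0 \<le> d x y \<and> d x y = d y x) \<and>
     (\<forall>x\<in>X. \<forall>y\<in>X. \<forall>z\<in>X. d x z \<le> d x y + d y z)"

text \<open>The value on the edge \<open>{u, v}\<close> of a function of two points that is symmetric on the
  edge; edges are unordered pairs, so without symmetry the description is meaningless.\<close>

definition on_edge :: "('v \<Rightarrow> 'v \<Rightarrow> real) \<Rightarrow> 'v set \<Rightarrow> real" where
  "on_edge f e = (THE r. \<exists>u v. e = {u, v} \<and> r = f u v)"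

lemma on_edge_eq: "f u v = f v u \<Longrightarrow> on_edge f {u, v} = f u v"
  unfolding on_edge_def by (rule the_equality) (auto simp: doubleton_eq_iff)


text \<open>Paths are defined for multigraphs with vertex set \<open>V\<close>, edge set \<open>F\<close> and a map \<open>ends\<close>
  assigning to each edge the set of its end points, since parallel edges occur in the
  multigraph underlying the Kuratowski network. For a simple graph, whose edges are
  two-element sets of vertices, \<open>ends\<close> is the identity.\<close>

definition is_path ::
  "'v set \<Rightarrow> 'e set \<Rightarrow> ('e \<Rightarrow> 'v set) \<Rightarrow> 'v \<Rightarrow> 'v list \<Rightarrow> 'e list \<Rightarrow> 'v \<Rightarrow> bool" where
  "is_path V F ends u vs es v \<longleftrightarrow>
     set vs \<subseteq> V \<and> distinct vs \<and> length vs = Suc (length es) \<and> hd vs = u \<and> last vs = v \<and>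
     (\<forall>i<length es. es ! i \<in> F \<and> ends (es ! i) = {vs ! i, vs ! Suc i})"

definition path_dist ::
  "'v set \<Rightarrow> 'e set \<Rightarrow> ('e \<Rightarrow> 'v set) \<Rightarrow> ('e \<Rightarrow> real) \<Rightarrow> 'v \<Rightarrow> 'v \<Rightarrow> real" where
  "path_dist V F ends w u v = Min {sum_list (map w es) |vs es. is_path V F ends u vs es v}"

definition simple_graph :: "'v set \<Rightarrow> 'v set set \<Rightarrow> bool" where
  "simple_graph V E \<longleftrightarrow> finite V \<and> (\<forall>e\<in>E. e \<subseteq> V \<and> card e = 2)"

definition connected_graph :: "'v set \<Rightarrow> 'v set set \<Rightarrow> bool" where
  "connected_graph V E \<longleftrightarrow>
     V \<noteq> {} \<and> (\<forall>u\<in>V. \<forall>v\<in>V. \<exists>vs es. is_path V E id u vs es v)"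

definition joins :: "'v set \<Rightarrow> 'v set set \<Rightarrow> 'v set \<Rightarrow> bool" where
  "joins V E M \<longleftrightarrow> simple_graph V E \<and> connected_graph V E \<and> M \<subseteq> V"

definition weighted_graph_iso ::
  "'v set \<Rightarrow> 'v set set \<Rightarrow> ('v set \<Rightarrow> real) \<Rightarrow>
   'w set \<Rightarrow> 'w set set \<Rightarrow> ('w set \<Rightarrow> real) \<Rightarrow> bool" where
  "weighted_graph_iso V E \<omega> V' E' \<omega>' \<longleftrightarrow>
     (\<exists>f. bij_betw f V V' \<and>
        (\<forall>u\<in>V. \<forall>v\<in>V. {u, v} \<in> E \<longleftrightarrow> {f u, f v} \<in> E') \<and>
        (\<forall>e\<in>E. \<omega>' (f ` e) = \<omega> e))"


text \<open>The type of a filling or network is the graph \<open>(V, E)\<close>, with boundary \<open>M\<close>. Weight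
  functions are total functions on sets of vertices of which only the values on \<open>E\<close> matter;
  likewise only the values of a network on \<open>V\<close> matter.\<close>

definition filling ::
  "'v set \<Rightarrow> 'v set set \<Rightarrow> 'v set \<Rightarrow> ('v \<Rightarrow> 'v \<Rightarrow> real) \<Rightarrow> ('v set \<Rightarrow> real) \<Rightarrow> bool" where
  "filling V E M \<rho> \<omega> \<longleftrightarrow>
     joins V E M \<and> (\<forall>e\<in>E. 0 \<le> \<omega> e) \<and>
     (\<forall>p\<in>M. \<forall>q\<in>M. \<rho> p q \<le> path_dist V E id \<omega> p q)"

definition minimal_parametric_filling ::
  "'v set \<Rightarrow> 'v set set \<Rightarrow> 'v set \<Rightarrow> ('v \<Rightarrow> 'v \<Rightarrow> real) \<Rightarrow> ('v set \<Rightarrow> real) \<Rightarrow> bool" where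
  "minimal_parametric_filling V E M \<rho> \<omega> \<longleftrightarrow>
     filling V E M \<rho> \<omega> \<and> (\<forall>\<omega>'. filling V E M \<rho> \<omega>' \<longrightarrow> sum \<omega> E \<le> sum \<omega>' E)"

definition induced_weight :: "('x \<Rightarrow> 'x \<Rightarrow> real) \<Rightarrow> ('v \<Rightarrow> 'x) \<Rightarrow> 'v set \<Rightarrow> real" where
  "induced_weight d \<Gamma> = on_edge (\<lambda>v w. d (\<Gamma> v) (\<Gamma> w))"

definition network_length ::
  "'v set set \<Rightarrow> ('x \<Rightarrow> 'x \<Rightarrow> real) \<Rightarrow> ('v \<Rightarrow> 'x) \<Rightarrow> real" where
  "network_length E d \<Gamma> = (\<Sum>e\<in>E. induced_weight d \<Gamma> e)"

definition network_with_boundary ::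
  "'v set \<Rightarrow> 'v set \<Rightarrow> 'x set \<Rightarrow> ('v \<Rightarrow> 'x) \<Rightarrow> ('v \<Rightarrow> 'x) \<Rightarrow> bool" where
  "network_with_boundary V M X \<phi> \<Gamma> \<longleftrightarrow> \<Gamma> ` V \<subseteq> X \<and> (\<forall>p\<in>M. \<Gamma> p = \<phi> p)"

definition minimal_parametric_network ::
  "'v set \<Rightarrow> 'v set set \<Rightarrow> 'v set \<Rightarrow> 'x set \<Rightarrow> ('x \<Rightarrow> 'x \<Rightarrow> real) \<Rightarrow>
   ('v \<Rightarrow> 'x) \<Rightarrow> ('v \<Rightarrow> 'x) \<Rightarrow> bool" where
  "minimal_parametric_network V E M X d \<phi> \<Gamma> \<longleftrightarrow>
     network_with_boundary V M X \<phi> \<Gamma> \<and>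
     (\<forall>\<Gamma>'. network_with_boundary V M X \<phi> \<Gamma>' \<longrightarrow>
        network_length E d \<Gamma> \<le> network_length E d \<Gamma>')"

text \<open>A network \<open>\<Gamma>\<close> of type \<open>(V, E)\<close> is isometric to the weighted graph \<open>(V', E', \<omega>')\<close>.\<close>

definition network_isometric ::
  "'v set \<Rightarrow> 'v set set \<Rightarrow> ('x \<Rightarrow> 'x \<Rightarrow> real) \<Rightarrow> ('v \<Rightarrow> 'x) \<Rightarrow>
   'w set \<Rightarrow> 'w set set \<Rightarrow> ('w set \<Rightarrow> real) \<Rightarrow> bool" where
  "network_isometric V E d \<Gamma> V' E' \<omega>' \<longleftrightarrow>
     weighted_graph_iso V' E' \<omega>' V E (induced_weight d \<Gamma>)"


text \<open>The norm of \<open>real ^ 'n\<close> is Euclidean; the maximum norm is \<^const>\<open>infnorm\<close>.\<close>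

definition linf_dist :: "real ^ 'n::finite \<Rightarrow> real ^ 'n \<Rightarrow> real" where
  "linf_dist x y = infnorm (x - y)"

text \<open>The points of \<open>M\<close> are enumerated by a bijection \<open>p\<close> from the index type \<open>'n\<close> to \<open>M\<close>.\<close>

definition kuratowski :: "('v \<Rightarrow> 'v \<Rightarrow> real) \<Rightarrow> ('n::finite \<Rightarrow> 'v) \<Rightarrow> 'v \<Rightarrow> real ^ 'n" where
  "kuratowski \<rho> p x = (\<chi> i. \<rho> x (p i))"

definition complete_edges :: "'v set \<Rightarrow> 'v set set" where
  "complete_edges M = {e. e \<subseteq> M \<and> card e = 2}"

text \<open>Least path weight in the multigraph with edge set the disjoint union of \<open>E\<close> and the edge
  set of the complete graph on \<open>M\<close>.\<close>

definition bar_dist ::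
  "'v set \<Rightarrow> 'v set set \<Rightarrow> 'v set \<Rightarrow> ('v \<Rightarrow> 'v \<Rightarrow> real) \<Rightarrow> ('v set \<Rightarrow> real) \<Rightarrow>
   'v \<Rightarrow> 'v \<Rightarrow> real" where
  "bar_dist V E M \<rho> \<omega> =
     path_dist V (E <+> complete_edges M) (case_sum id id) (case_sum \<omega> (on_edge \<rho>))"

definition kuratowski_network ::
  "'v set \<Rightarrow> 'v set set \<Rightarrow> 'v set \<Rightarrow> ('v \<Rightarrow> 'v \<Rightarrow> real) \<Rightarrow> ('n::finite \<Rightarrow> 'v) \<Rightarrow>
   ('v set \<Rightarrow> real) \<Rightarrow> 'v \<Rightarrow> real ^ 'n" where
  "kuratowski_network V E M \<rho> p \<omega> v = (\<chi> i. bar_dist V E M \<rho> \<omega> v (p i))"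

end

theory Submission
  imports Defs
begin

text \<open>
  The proof compares fillings and networks of type \<open>G\<close> in both directions.

  A network \<open>\<Gamma>\<close> with boundary the Kuratowski isometry induces a filling of the same weight
  (\<open>filling_induced_weight\<close>): the coordinate of \<open>\<Gamma>\<close> belonging to \<open>q \<in> M\<close> changes along an edge
  by at most the induced weight, and in total by \<open>\<rho>(p, q)\<close> along a path from \<open>p\<close> to \<open>q\<close>.

  Conversely, the Kuratowski network of a filling \<open>\<omega>\<close> has the right boundary
  (\<open>bar_dist_boundary\<close>), and its induced weight is at most \<open>\<omega>\<close> on every edge
  (\<open>induced_weight_kuratowski_network_le\<close>), since the coordinates of the network,
  \<open>v \<mapsto> bar_dist V E M \<rho> \<omega> v (p i)\<close>, are 1-Lipschitz along the edges of \<open>G\<close>. That the boundary is right needs the inequality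
  \<open>\<rho> a q \<le> bar_dist V E M \<rho> \<omega> a q\<close> for \<open>a, q \<in> M\<close>.
  Instead of cutting a path in the multigraph at its visits to \<open>M\<close>, the proof uses the potential
  \<open>h(v) = min\<^bsub>m \<in> M\<^esub> (d\<^bsub>\<omega>\<^esub>(v, m) + \<rho>(m, q))\<close>, which is 1-Lipschitz along both kinds of edges and
  equals \<open>\<rho>(v, q)\<close> for \<open>v \<in> M\<close>.

  Hence a minimal filling equals the induced weight of its Kuratowski network edge by edge (that
  weight is a filling bounded by it), the least weight of a filling and the least length of a
  network agree, and the two statements about minimal objects follow. A minimal filling exists by
  compactness: the fillings with values in \<open>[0, c]\<close> form a closed subset of a product of compact
  intervals, and for large \<open>c\<close> the other fillings are too heavy to matter.
\<close>

section \<open>Paths\<close>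

lemma is_path_Nil:
  "is_path V F ends u vs [] v \<longleftrightarrow> vs = [u] \<and> u = v \<and> u \<in> V"
  unfolding is_path_def by (cases vs) auto

lemma is_path_Cons:
  "is_path V F ends u vs (e # es) v \<longleftrightarrow>
     (\<exists>vs' u'. vs = u # vs' \<and> u \<in> V \<and> u \<notin> set vs' \<and> e \<in> F \<and> ends e = {u, u'} \<and>
        is_path V F ends u' vs' es v)"
  (is "?L \<longleftrightarrow> ?R")
proof
  assume L: ?L
  then have len: "length vs = Suc (Suc (length es))"
    by (simp add: is_path_def)
  then obtain a b xs where vs: "vs = a # b # xs"
    by (auto simp: length_Suc_conv)
  have edge: "(e # es) ! i \<in> F \<and> ends ((e # es) ! i) = {vs ! i, vs ! Suc i}"
    if "i < Suc (length es)" for i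
    using L that unfolding is_path_def by simp
  have "e \<in> F \<and> ends e = {a, b}"
    using edge[of 0] vs by simp
  moreover have "es ! i \<in> F \<and> ends (es ! i) = {(b # xs) ! i, (b # xs) ! Suc i}"
    if "i < length es" for i
    using edge[of "Suc i"] that vs by simp
  ultimately have "vs = u # b # xs \<and> u \<in> V \<and> u \<notin> set (b # xs) \<and> e \<in> F \<and> ends e = {u, b} \<and>
      is_path V F ends b (b # xs) es v"
    using L vs unfolding is_path_def by auto
  then show ?R by blast
next
  assume ?R
  then obtain vs' u' where R: "vs = u # vs'" "u \<in> V" "u \<notin> set vs'" "e \<in> F" "ends e = {u, u'}"
      "is_path V F ends u' vs' es v"
    by blast
  then have ne: "vs' \<noteq> []" and "hd vs' = u'"
    by (auto simp: is_path_def)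
  then have hd: "vs' ! 0 = u'"
    by (simp add: hd_conv_nth)
  have "(e # es) ! i \<in> F \<and> ends ((e # es) ! i) = {vs ! i, vs ! Suc i}"
    if "i < length (e # es)" for i
    using that R hd by (cases i) (auto simp: is_path_def)
  then show ?L
    using R ne unfolding is_path_def by auto
qed

lemma is_path_ends:
  assumes "is_path V F ends u vs es v"
  shows "u \<in> set vs" "v \<in> set vs" "u \<in> V" "v \<in> V"
proof -
  have "vs \<noteq> []" using assms by (auto simp: is_path_def)
  then have "hd vs \<in> set vs" "last vs \<in> set vs" by simp_all
  then show "u \<in> set vs" "v \<in> set vs" "u \<in> V" "v \<in> V"
    using assms by (auto simp: is_path_def)
qed

text \<open>Used with \<open>h\<close> a coordinate of a network, and with \<open>h\<close> the potential on the multigraph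
  in the proof of \<open>bar_dist_boundary\<close>.\<close>

lemma path_weight_ge_potential_diff:
  fixes h :: "'v \<Rightarrow> real"
  assumes "is_path V F ends u vs es v"
    and "\<And>e a b. e \<in> F \<Longrightarrow> ends e = {a, b} \<Longrightarrow> a \<in> V \<Longrightarrow> b \<in> V \<Longrightarrow> h a - h b \<le> w e"
  shows "h u - h v \<le> sum_list (map w es)"
  using assms(1)
proof (induction es arbitrary: u vs)
  case Nil
  then show ?case by (simp add: is_path_Nil)
next
  case (Cons e es)
  from Cons.prems obtain vs' u' where *: "u \<in> V" "e \<in> F" "ends e = {u, u'}"
      and p: "is_path V F ends u' vs' es v"
    by (auto simp: is_path_Cons)
  have "h u - h u' \<le> w e"
    using assms(2)[OF *(2,3,1)] is_path_ends(3)[OF p] by blast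
  with Cons.IH[OF p] show ?case by simp
qed

lemma is_path_suffix:
  fixes w :: "'e \<Rightarrow> real"
  assumes "is_path V F ends v vs es q" and "u \<in> set vs" and "\<And>e. e \<in> F \<Longrightarrow> 0 \<le> w e"
  shows "\<exists>vs' es'. is_path V F ends u vs' es' q \<and> sum_list (map w es') \<le> sum_list (map w es)"
  using assms(1,2)
proof (induction es arbitrary: v vs)
  case Nil
  then have "is_path V F ends u vs [] q"
    by (auto simp: is_path_Nil)
  then show ?case by (metis order_refl)
next
  case (Cons e es)
  from Cons.prems(1) obtain vs' v' where *: "vs = v # vs'" "e \<in> F"
      and p: "is_path V F ends v' vs' es q"
    by (auto simp: is_path_Cons)
  show ?case
  proof (cases "u = v")
    case True
    then show ?thesis using Cons.prems(1) by blast
  next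
    case False
    then have "u \<in> set vs'" using Cons.prems(2) * by simp
    then obtain ws fs where "is_path V F ends u ws fs q"
        "sum_list (map w fs) \<le> sum_list (map w es)"
      using Cons.IH[OF p] by blast
    moreover have "0 \<le> w e" using assms(3) * by blast
    ultimately show ?thesis by (intro exI[of _ ws] exI[of _ fs]) simp
  qed
qed

lemma finite_path_weights:
  fixes w :: "'e \<Rightarrow> real"
  assumes "finite V" "finite F"
  shows "finite {sum_list (map w es) |vs es. is_path V F ends u vs es v}"
proof -
  have "set es \<subseteq> F \<and> length es \<le> card V" if "is_path V F ends u vs es v" for vs es
  proof -
    have "length vs = card (set vs)" "set vs \<subseteq> V"
      using that by (auto simp: is_path_def distinct_card)
    then have "length vs \<le> card V"
      using card_mono[OF assms(1)] by metis
    with that show ?thesis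
      by (auto simp: is_path_def in_set_conv_nth)
  qed
  then have "{sum_list (map w es) |vs es. is_path V F ends u vs es v}
      \<subseteq> (\<lambda>es. sum_list (map w es)) ` {es. set es \<subseteq> F \<and> length es \<le> card V}"
    by blast
  then show ?thesis
    using finite_lists_length_le[OF assms(2)] finite_surj by blast
qed

lemma path_dist_le:
  assumes "finite V" "finite F" "is_path V F ends u vs es v"
  shows "path_dist V F ends w u v \<le> sum_list (map w es)"
  unfolding path_dist_def using assms by (intro Min_le finite_path_weights) auto

lemma path_dist_attained:
  assumes "finite V" "finite F" "\<exists>vs es. is_path V F ends u vs es v"
  obtains vs es where "is_path V F ends u vs es v"
    "path_dist V F ends w u v = sum_list (map w es)"
proof -
  have "path_dist V F ends w u v \<in> {sum_list (map w es) |vs es. is_path V F ends u vs es v}"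
    unfolding path_dist_def using assms by (intro Min_in finite_path_weights) auto
  then show ?thesis using that by blast
qed

lemma le_path_dist_iff:
  assumes "finite V" "finite F" "\<exists>vs es. is_path V F ends u vs es v"
  shows "r \<le> path_dist V F ends w u v \<longleftrightarrow>
    (\<forall>vs es. is_path V F ends u vs es v \<longrightarrow> r \<le> sum_list (map w es))"
proof -
  obtain vs es where "is_path V F ends u vs es v"
      "path_dist V F ends w u v = sum_list (map w es)"
    using path_dist_attained[OF assms] .
  then show ?thesis
    using path_dist_le[OF assms(1,2), of ends u _ _ v w] by (auto intro: order_trans)
qed

lemma path_dist_self_le:
  assumes "finite V" "finite F" "v \<in> V"
  shows "path_dist V F ends w v v \<le> 0"
  using path_dist_le[OF assms(1,2), of ends v "[v]" "[]" v w] assms(3)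
  by (simp add: is_path_Nil)

text \<open>Prepending the edge \<open>e\<close> to a path need not give a path, as paths do not repeat vertices; in
  that case a final segment of the path already starts at \<open>u\<close>, and it is no heavier.\<close>

lemma path_dist_edge_le:
  assumes fin: "finite V" "finite F" and conn: "\<exists>vs es. is_path V F ends v vs es q"
    and nonneg: "\<And>e. e \<in> F \<Longrightarrow> 0 \<le> w e"
    and e: "e \<in> F" "ends e = {u, v}" "u \<in> V"
  shows "path_dist V F ends w u q \<le> w e + path_dist V F ends w v q"
proof -
  obtain vs es where p: "is_path V F ends v vs es q"
      and d: "path_dist V F ends w v q = sum_list (map w es)"
    using path_dist_attained[OF fin conn] by metis
  show ?thesis
  proof (cases "u \<in> set vs")
    case True
    then obtain vs' es' where p': "is_path V F ends u vs' es' q"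
        and le: "sum_list (map w es') \<le> sum_list (map w es)"
      using is_path_suffix[OF p True, of w] nonneg by blast
    show ?thesis
      using path_dist_le[OF fin p', of w] le d nonneg[OF e(1)] by linarith
  next
    case False
    then have "is_path V F ends u (u # vs) (e # es) q"
      using p e by (auto simp: is_path_Cons)
    from path_dist_le[OF fin this, of w] d show ?thesis by simp
  qed
qed


section \<open>Type graphs and the maximum norm\<close>

lemma joinsD:
  assumes "joins V E M"
  shows "finite V" "finite E" "finite M" "M \<subseteq> V"
    and "\<And>u v. u \<in> V \<Longrightarrow> v \<in> V \<Longrightarrow> \<exists>vs es. is_path V E id u vs es v"
proof -
  show fin: "finite V" and sub: "M \<subseteq> V"
    using assms by (auto simp: joins_def simple_graph_def)
  have "E \<subseteq> Pow V"
    using assms by (auto simp: joins_def simple_graph_def)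
  then show "finite E" using fin by (meson finite_Pow_iff finite_subset)
  show "finite M" using fin sub finite_subset by blast
  show "\<And>u v. u \<in> V \<Longrightarrow> v \<in> V \<Longrightarrow> \<exists>vs es. is_path V E id u vs es v"
    using assms by (auto simp: joins_def connected_graph_def)
qed

lemma joins_edgeE:
  assumes "joins V E M" "e \<in> E"
  obtains u v where "e = {u, v}" "u \<in> V" "v \<in> V"
  using assms unfolding joins_def simple_graph_def by (auto simp: card_2_iff)

lemma linf_dist_commute: "linf_dist x y = linf_dist y x"
  unfolding linf_dist_def by (rule infnorm_sub)

lemma component_diff_le_linf_dist: "x $ i - y $ i \<le> linf_dist x y"
  using component_le_infnorm_cart[of "x - y" i] unfolding linf_dist_def by simp

lemma linf_dist_le:
  assumes "\<And>i. \<bar>x $ i - y $ i\<bar> \<le> r"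
  shows "linf_dist x y \<le> r"
  unfolding linf_dist_def infnorm_cart by (rule cSup_least) (use assms in auto)

lemma induced_weight_linf:
  "induced_weight linf_dist \<Gamma> {u, v} = linf_dist (\<Gamma> u) (\<Gamma> v)"
  unfolding induced_weight_def by (rule on_edge_eq) (rule linf_dist_commute)


section \<open>From networks to fillings\<close>

lemma filling_induced_weight:
  fixes p :: "'n::finite \<Rightarrow> 'v"
  assumes pm: "pseudo_metric_on M \<rho>" and bij: "bij_betw p UNIV M" and J: "joins V E M"
    and \<Gamma>: "network_with_boundary V M UNIV (kuratowski \<rho> p) \<Gamma>"
  shows "filling V E M \<rho> (induced_weight linf_dist \<Gamma>)"
proof -
  note j = joinsD[OF J]
  have nonneg: "0 \<le> induced_weight linf_dist \<Gamma> e" if "e \<in> E" for e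
    using joins_edgeE[OF J that]
    by (metis induced_weight_linf infnorm_pos_le linf_dist_def)
  moreover have "\<rho> a b \<le> path_dist V E id (induced_weight linf_dist \<Gamma>) a b"
    if ab: "a \<in> M" "b \<in> M" for a b
  proof -
    \<comment> \<open>The coordinate belonging to \<open>b\<close> attains the whole distance \<open>\<rho> a b\<close>.\<close>
    obtain i where i: "p i = b"
      using bij ab(2) by (auto simp: bij_betw_def)
    have "\<Gamma> a $ i = \<rho> a b" "\<Gamma> b $ i = 0"
      using \<Gamma> ab i pm by (auto simp: network_with_boundary_def kuratowski_def pseudo_metric_on_def)
    then have "\<rho> a b \<le> sum_list (map (induced_weight linf_dist \<Gamma>) es)"
      if "is_path V E id a vs es b" for vs es
      using path_weight_ge_potential_diff[OF that, of "\<lambda>v. \<Gamma> v $ i" "induced_weight linf_dist \<Gamma>"]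
      by (auto simp: induced_weight_linf component_diff_le_linf_dist)
    then show ?thesis
      using le_path_dist_iff[OF j(1,2) j(5)] ab j(4) by blast
  qed
  ultimately show ?thesis
    using J unfolding filling_def by blast
qed


section \<open>From fillings to networks\<close>

lemma finite_complete_edges: "finite M \<Longrightarrow> finite (complete_edges M)"
  unfolding complete_edges_def by simp

lemma bar_edges_finite:
  assumes "joins V E M"
  shows "finite (E <+> complete_edges M)"
  using joinsD(2,3)[OF assms] by (simp add: finite_complete_edges)

lemma bar_connected:
  assumes "joins V E M" "u \<in> V" "v \<in> V"
  shows "\<exists>vs es. is_path V (E <+> complete_edges M) (case_sum id id) u vs es v"
proof -
  obtain vs es where "is_path V E id u vs es v"
    using joinsD(5)[OF assms] by blast
  then have "is_path V (E <+> complete_edges M) (case_sum id id) u vs (map Inl es) v"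
    by (auto simp: is_path_def)
  then show ?thesis by blast
qed

lemma complete_edgesE:
  assumes "e \<in> complete_edges M"
  obtains a b where "e = {a, b}" "a \<in> M" "b \<in> M" "a \<noteq> b"
  using assms unfolding complete_edges_def by (auto simp: card_2_iff)

lemma on_edge_pseudo_metric:
  assumes "pseudo_metric_on M \<rho>" "a \<in> M" "b \<in> M"
  shows "on_edge \<rho> {a, b} = \<rho> a b"
  by (rule on_edge_eq) (use assms in \<open>unfold pseudo_metric_on_def, blast\<close>)

lemma bar_weight_nonneg:
  assumes pm: "pseudo_metric_on M \<rho>" and "\<And>e. e \<in> E \<Longrightarrow> 0 \<le> \<omega> e"
    and "e \<in> E <+> complete_edges M"
  shows "0 \<le> case_sum \<omega> (on_edge \<rho>) e"
proof (cases e)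
  case (Inl f)
  then show ?thesis using assms(2,3) by auto
next
  case (Inr f)
  then have "f \<in> complete_edges M" using assms(3) by auto
  then obtain a b where ab: "f = {a, b}" "a \<in> M" "b \<in> M"
    by (rule complete_edgesE)
  then have "0 \<le> \<rho> a b"
    using pm unfolding pseudo_metric_on_def by blast
  then show ?thesis
    using Inr ab on_edge_pseudo_metric[OF pm ab(2,3)] by simp
qed

lemma bar_dist_boundary:
  assumes pm: "pseudo_metric_on M \<rho>" and fil: "filling V E M \<rho> \<omega>"
    and a: "a \<in> M" and q: "q \<in> M"
  shows "bar_dist V E M \<rho> \<omega> a q = \<rho> a q"
proof (rule antisym)
  have J: "joins V E M" and pos: "\<And>e. e \<in> E \<Longrightarrow> 0 \<le> \<omega> e"
    and fil': "\<And>a b. a \<in> M \<Longrightarrow> b \<in> M \<Longrightarrow> \<rho> a b \<le> path_dist V E id \<omega> a b"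
    using fil by (auto simp: filling_def)
  note j = joinsD[OF J]
  note fin = j(1) bar_edges_finite[OF J]
  have tri: "\<rho> x z \<le> \<rho> x y + \<rho> y z" if "x \<in> M" "y \<in> M" "z \<in> M" for x y z
    using pm that by (auto simp: pseudo_metric_on_def)
  show "bar_dist V E M \<rho> \<omega> a q \<le> \<rho> a q"
  proof (cases "a = q")
    case True
    moreover have "\<rho> q q = 0" using pm q by (auto simp: pseudo_metric_on_def)
    moreover have "q \<in> V" using q j(4) by blast
    ultimately show ?thesis
      unfolding bar_dist_def using path_dist_self_le[OF fin] by simp
  next
    case False
    then have "{a, q} \<in> complete_edges M"
      using a q by (auto simp: complete_edges_def)
    then have "is_path V (E <+> complete_edges M) (case_sum id id) a [a, q] [Inr {a, q}] q"
      using a q j(4) False by (auto simp: is_path_Cons is_path_Nil)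
    from path_dist_le[OF fin this, of "case_sum \<omega> (on_edge \<rho>)"] show ?thesis
      by (simp add: bar_dist_def on_edge_pseudo_metric[OF pm a q])
  qed
  \<comment> \<open>For the other inequality: a potential that is 1-Lipschitz along both kinds of edges and
    agrees with \<open>\<lambda>v. \<rho> v q\<close> on \<open>M\<close>.\<close>
  define h where "h v = Min ((\<lambda>m. path_dist V E id \<omega> v m + \<rho> m q) ` M)" for v
  have M: "finite M" "M \<noteq> {}" using j(3) q by auto
  have h_le: "h v \<le> path_dist V E id \<omega> v m + \<rho> m q" if "m \<in> M" for v m
    unfolding h_def using M that by (intro Min_le) auto
  have h_att: "\<exists>m\<in>M. h v = path_dist V E id \<omega> v m + \<rho> m q" for v
    using Min_in[of "(\<lambda>m. path_dist V E id \<omega> v m + \<rho> m q) ` M"] M unfolding h_def by blast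
  have h_M: "h m = \<rho> m q" if m: "m \<in> M" for m
  proof (rule antisym)
    show "h m \<le> \<rho> m q"
      using h_le[OF m, of m] path_dist_self_le[OF j(1,2), of m id \<omega>] m j(4) by auto
    obtain m' where "m' \<in> M" "h m = path_dist V E id \<omega> m m' + \<rho> m' q"
      using h_att by blast
    then show "\<rho> m q \<le> h m"
      using fil'[OF m] tri[OF m _ q] by fastforce
  qed
  have lip_E: "h x - h y \<le> \<omega> {x, y}" if e: "{x, y} \<in> E" "x \<in> V" "y \<in> V" for x y
  proof -
    obtain m where m: "m \<in> M" "h y = path_dist V E id \<omega> y m + \<rho> m q"
      using h_att by blast
    have "path_dist V E id \<omega> x m \<le> \<omega> {x, y} + path_dist V E id \<omega> y m"
      using e m j(4) by (intro path_dist_edge_le j pos) auto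
    then show ?thesis using h_le[OF m(1), of x] m(2) by linarith
  qed
  have lip: "h x - h y \<le> case_sum \<omega> (on_edge \<rho>) e"
    if "e \<in> E <+> complete_edges M" "case_sum id id e = {x, y}" "x \<in> V" "y \<in> V" for e x y
  proof (cases e)
    case (Inl f)
    then show ?thesis using that lip_E by auto
  next
    case (Inr f)
    then have f: "f = {x, y}" "x \<in> M" "y \<in> M"
      using that by (auto simp: complete_edges_def)
    then show ?thesis
      using Inr tri[OF f(2,3) q] by (simp add: h_M on_edge_pseudo_metric[OF pm])
  qed
  have "\<rho> a q \<le> sum_list (map (case_sum \<omega> (on_edge \<rho>)) es)"
    if "is_path V (E <+> complete_edges M) (case_sum id id) a vs es q" for vs es
  proof -
    have "\<rho> q q = 0" using pm q by (auto simp: pseudo_metric_on_def)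
    then show ?thesis
      using path_weight_ge_potential_diff[OF that, of h "case_sum \<omega> (on_edge \<rho>)"] lip
      by (auto simp: h_M a q)
  qed
  moreover have "a \<in> V" "q \<in> V" using a q j(4) by auto
  ultimately show "\<rho> a q \<le> bar_dist V E M \<rho> \<omega> a q"
    unfolding bar_dist_def using le_path_dist_iff[OF fin bar_connected[OF J]] by blast
qed

lemma kuratowski_network_boundary:
  fixes p :: "'n::finite \<Rightarrow> 'v"
  assumes "pseudo_metric_on M \<rho>" "bij_betw p UNIV M" "filling V E M \<rho> \<omega>"
  shows "network_with_boundary V M UNIV (kuratowski \<rho> p) (kuratowski_network V E M \<rho> p \<omega>)"
proof -
  have "p i \<in> M" for i
    using assms(2) by (auto simp: bij_betw_def)
  then show ?thesis
    using bar_dist_boundary[OF assms(1,3)]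
    by (simp add: network_with_boundary_def kuratowski_network_def kuratowski_def vec_eq_iff)
qed

lemma induced_weight_kuratowski_network_le:
  fixes p :: "'n::finite \<Rightarrow> 'v"
  assumes pm: "pseudo_metric_on M \<rho>" and bij: "bij_betw p UNIV M"
    and fil: "filling V E M \<rho> \<omega>" and e: "e \<in> E"
  shows "induced_weight linf_dist (kuratowski_network V E M \<rho> p \<omega>) e \<le> \<omega> e"
proof -
  have J: "joins V E M" and pos: "\<And>e. e \<in> E \<Longrightarrow> 0 \<le> \<omega> e"
    using fil by (auto simp: filling_def)
  note j = joinsD[OF J]
  obtain u v where uv: "e = {u, v}" "u \<in> V" "v \<in> V"
    using joins_edgeE[OF J e] by blast
  have pV: "p i \<in> V" for i
    using bij j(4) by (auto simp: bij_betw_def)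
  have step: "bar_dist V E M \<rho> \<omega> x (p i) \<le> \<omega> e + bar_dist V E M \<rho> \<omega> y (p i)"
    if xy: "e = {x, y}" "x \<in> V" "y \<in> V" for x y i
  proof -
    have nonneg: "0 \<le> case_sum \<omega> (on_edge \<rho>) f" if "f \<in> E <+> complete_edges M" for f
      using bar_weight_nonneg[OF pm pos that] .
    show ?thesis
      unfolding bar_dist_def
      using path_dist_edge_le[OF j(1) bar_edges_finite[OF J] bar_connected[OF J xy(3) pV],
          of "case_sum \<omega> (on_edge \<rho>)" "Inl e" x i] nonneg xy e
      by auto
  qed
  have "\<bar>bar_dist V E M \<rho> \<omega> u (p i) - bar_dist V E M \<rho> \<omega> v (p i)\<bar> \<le> \<omega> e" for i
    using step[of u v i] step[of v u i] uv by (simp add: insert_commute abs_le_iff)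
  then show ?thesis
    unfolding uv(1) induced_weight_linf
    by (intro linf_dist_le) (simp add: kuratowski_network_def)
qed


section \<open>Existence of a minimal filling\<close>

text \<open>Stated path by path, the filling condition is a family of weak linear inequalities in the
  weights; hence the set of fillings is closed.\<close>

lemma filling_iff:
  assumes "joins V E M"
  shows "filling V E M \<rho> \<omega> \<longleftrightarrow> (\<forall>e\<in>E. 0 \<le> \<omega> e) \<and>
    (\<forall>a\<in>M. \<forall>b\<in>M. \<forall>vs es. is_path V E id a vs es b \<longrightarrow> \<rho> a b \<le> sum_list (map \<omega> es))"
proof -
  note j = joinsD[OF assms]
  have "\<rho> a b \<le> path_dist V E id \<omega> a b \<longleftrightarrow>
      (\<forall>vs es. is_path V E id a vs es b \<longrightarrow> \<rho> a b \<le> sum_list (map \<omega> es))"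
    if "a \<in> M" "b \<in> M" for a b
    using le_path_dist_iff[OF j(1,2) j(5)] that j(4) by blast
  then show ?thesis
    using assms unfolding filling_def by blast
qed

lemma filling_cong:
  assumes "joins V E M" "\<And>e. e \<in> E \<Longrightarrow> \<omega> e = \<omega>' e"
  shows "filling V E M \<rho> \<omega> \<longleftrightarrow> filling V E M \<rho> \<omega>'"
proof -
  have "sum_list (map \<omega> es) = sum_list (map \<omega>' es)"
    if "is_path V E id a vs es b" for a vs es b
  proof (intro arg_cong[where f = sum_list] map_cong refl)
    fix e assume "e \<in> set es"
    then have "e \<in> E" using that unfolding is_path_def in_set_conv_nth by blast
    then show "\<omega> e = \<omega>' e" by (rule assms(2))
  qed
  then show ?thesis
    unfolding filling_iff[OF assms(1)] using assms(2)
    by (intro conj_cong ball_cong iff_allI imp_cong refl) auto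
qed

lemma filling_exists:
  assumes pm: "pseudo_metric_on M \<rho>" and J: "joins V E M"
  shows "\<exists>\<omega>. filling V E M \<rho> \<omega>"
proof -
  note j = joinsD[OF J]
  \<comment> \<open>A path between distinct points has an edge, so a constant weight bounding \<open>\<rho>\<close> is a filling.\<close>
  define c where "c = (\<Sum>a\<in>M. \<Sum>b\<in>M. \<rho> a b)"
  have nn: "0 \<le> \<rho> a b" if "a \<in> M" "b \<in> M" for a b
    using pm that by (auto simp: pseudo_metric_on_def)
  have c: "\<rho> a b \<le> c" if "a \<in> M" "b \<in> M" for a b
  proof -
    have "\<rho> a b \<le> (\<Sum>b\<in>M. \<rho> a b)"
      using that nn j(3) by (intro member_le_sum) auto
    also have "\<dots> \<le> c"
      unfolding c_def using that nn j(3)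
      by (intro member_le_sum[where f = "\<lambda>a. \<Sum>b\<in>M. \<rho> a b"]) (auto intro: sum_nonneg)
    finally show ?thesis .
  qed
  have c0: "0 \<le> c"
    unfolding c_def by (intro sum_nonneg nn)
  have "\<rho> a b \<le> sum_list (map (\<lambda>_. c) es)"
    if "a \<in> M" "b \<in> M" "is_path V E id a vs es b" for a b vs es
  proof (cases es)
    case Nil
    then show ?thesis
      using that pm by (auto simp: is_path_Nil pseudo_metric_on_def)
  next
    case (Cons e es')
    have "0 \<le> sum_list (map (\<lambda>_. c) es')"
      using c0 by (intro sum_list_nonneg) auto
    then show ?thesis using c[OF that(1,2)] Cons by simp
  qed
  then have "filling V E M \<rho> (\<lambda>_. c)"
    using c0 unfolding filling_iff[OF J] by blast
  then show ?thesis by blast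
qed

lemma minimal_parametric_filling_exists:
  assumes pm: "pseudo_metric_on M \<rho>" and J: "joins V E M"
  shows "\<exists>\<omega>. minimal_parametric_filling V E M \<rho> \<omega>"
proof -
  note j = joinsD[OF J]
  obtain \<omega>0 where \<omega>0: "filling V E M \<rho> \<omega>0"
    using filling_exists[OF assms] by blast
  define c where "c = sum \<omega>0 E"
  \<comment> \<open>Off the edge set the weights are irrelevant; setting them to \<open>0\<close> gives a compact product.\<close>
  define K where "K = PiE UNIV (\<lambda>e. if e \<in> E then {0..c} else {0})"
  define S where "S = K \<inter> {\<omega>. filling V E M \<rho> \<omega>}"
  define cut where "cut \<omega> e = (if e \<in> E then \<omega> e else 0)" for \<omega> :: "'a set \<Rightarrow> real" and e
  have sum_cut: "sum (cut \<omega>) E = sum \<omega> E" for \<omega>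
    by (intro sum.cong) (auto simp: cut_def)
  have cut_S: "cut \<omega> \<in> S" if \<omega>: "filling V E M \<rho> \<omega>" "sum \<omega> E \<le> c" for \<omega>
  proof -
    have pos: "\<And>e. e \<in> E \<Longrightarrow> 0 \<le> \<omega> e" using \<omega>(1) by (auto simp: filling_def)
    have "\<omega> e \<le> c" if "e \<in> E" for e
      using member_le_sum[of e E \<omega>] that pos j(2) \<omega>(2) by fastforce
    then have "cut \<omega> \<in> K"
      using pos by (auto simp: K_def cut_def)
    moreover have "filling V E M \<rho> (cut \<omega>)"
      using \<omega>(1) filling_cong[OF J, of \<omega> "cut \<omega>"] by (simp add: cut_def)
    ultimately show ?thesis by (simp add: S_def)
  qed
  have "compact K"
    unfolding K_def compactin_euclidean_iff[symmetric] euclidean_product_topology[symmetric]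
      compactin_PiE by auto
  have cont: "continuous_on UNIV (\<lambda>\<omega>::'a set \<Rightarrow> real. \<omega> e)" for e
    by (rule continuous_on_product_coordinates)
  have cont_list: "continuous_on UNIV (\<lambda>\<omega>::'a set \<Rightarrow> real. sum_list (map \<omega> es))" for es
    by (induction es) (auto intro!: continuous_intros cont)
  have "{\<omega>. filling V E M \<rho> \<omega>} = (\<Inter>e\<in>E. {\<omega>. 0 \<le> \<omega> e}) \<inter>
      (\<Inter>(a, b, es)\<in>{(a, b, es). a \<in> M \<and> b \<in> M \<and> (\<exists>vs. is_path V E id a vs es b)}.
         {\<omega>. \<rho> a b \<le> sum_list (map \<omega> es)})"
    unfolding filling_iff[OF J] by auto
  also have "closed \<dots>"
    by (intro closed_Int closed_INT ballI)
       (auto intro!: closed_Collect_le continuous_intros cont cont_list)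
  finally have "compact S"
    unfolding S_def using \<open>compact K\<close> by (rule compact_Int_closed[rotated])
  moreover have "S \<noteq> {}"
    using cut_S[OF \<omega>0] by (auto simp: c_def)
  moreover have "continuous_on S (\<lambda>\<omega>. sum \<omega> E)"
    by (intro continuous_intros continuous_on_subset[OF cont]) simp
  ultimately obtain \<omega> where \<omega>: "\<omega> \<in> S" "\<And>\<omega>'. \<omega>' \<in> S \<Longrightarrow> sum \<omega> E \<le> sum \<omega>' E"
    using continuous_attains_inf by metis
  have "sum \<omega> E \<le> c"
    using \<omega>(2)[OF cut_S[OF \<omega>0]] sum_cut by (simp add: c_def)
  then have "sum \<omega> E \<le> sum \<omega>' E" if "filling V E M \<rho> \<omega>'" for \<omega>'
    using \<omega>(2)[OF cut_S[OF that]] sum_cut by (cases "sum \<omega>' E \<le> c") auto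
  with \<omega>(1) show ?thesis
    unfolding minimal_parametric_filling_def S_def by blast
qed


section \<open>Minimal fillings and minimal networks\<close>

lemma network_isometric_self:
  assumes "\<And>e. e \<in> E \<Longrightarrow> induced_weight d \<Gamma> e = \<omega> e"
  shows "network_isometric V E d \<Gamma> V E \<omega>"
  unfolding network_isometric_def weighted_graph_iso_def
  using assms by (intro exI[of _ id]) (auto simp: bij_betw_id)

theorem corollary3p2:
  fixes M V :: "'v set" and E :: "'v set set"
    and \<rho> :: "'v \<Rightarrow> 'v \<Rightarrow> real" and p :: "'n::finite \<Rightarrow> 'v"
  assumes "pseudo_metric_on M \<rho>"
    and "bij_betw p UNIV M"
    and "joins V E M"
  shows "(\<exists>\<omega>. minimal_parametric_filling V E M \<rho> \<omega>) \<and>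
    (\<forall>\<omega>. minimal_parametric_filling V E M \<rho> \<omega> \<longrightarrow>
       network_isometric V E linf_dist (kuratowski_network V E M \<rho> p \<omega>) V E \<omega> \<and>
       minimal_parametric_network V E M UNIV linf_dist (kuratowski \<rho> p)
         (kuratowski_network V E M \<rho> p \<omega>)) \<and>
    (\<forall>\<Gamma>. minimal_parametric_network V E M UNIV linf_dist (kuratowski \<rho> p) \<Gamma> \<longrightarrow>
       (\<exists>\<omega>. minimal_parametric_filling V E M \<rho> \<omega> \<and>
            network_isometric V E linf_dist \<Gamma> V E \<omega>))"
proof (intro conjI allI impI)
  note boundary = kuratowski_network_boundary[OF assms(1,2)]
  note filling_of = filling_induced_weight[OF assms]
  note weight_le = induced_weight_kuratowski_network_le[OF assms(1,2)]
  show "\<exists>\<omega>. minimal_parametric_filling V E M \<rho> \<omega>"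
    using minimal_parametric_filling_exists[OF assms(1,3)] .
  show "network_isometric V E linf_dist (kuratowski_network V E M \<rho> p \<omega>) V E \<omega>"
    if "minimal_parametric_filling V E M \<rho> \<omega>" for \<omega>
  proof (rule network_isometric_self)
    fix e assume e: "e \<in> E"
    let ?w = "induced_weight linf_dist (kuratowski_network V E M \<rho> p \<omega>)"
    have fil: "filling V E M \<rho> \<omega>" and "sum \<omega> E \<le> sum ?w E"
      using that filling_of[OF boundary] by (auto simp: minimal_parametric_filling_def)
    moreover have "sum ?w E \<le> sum \<omega> E"
      by (intro sum_mono weight_le fil)
    \<comment> \<open>Equal sums and the edgewise inequality force edgewise equality.\<close>
    ultimately have "sum ?w E = sum \<omega> E" by simp
    then show "?w e = \<omega> e"
      using sum_mono_inv[of ?w E \<omega> e] weight_le[OF fil] e joinsD(2)[OF assms(3)] by simp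
  qed
  show "minimal_parametric_network V E M UNIV linf_dist (kuratowski \<rho> p)
      (kuratowski_network V E M \<rho> p \<omega>)"
    if "minimal_parametric_filling V E M \<rho> \<omega>" for \<omega>
    unfolding minimal_parametric_network_def
  proof (intro conjI allI impI)
    have fil: "filling V E M \<rho> \<omega>"
      and min: "\<And>\<omega>'. filling V E M \<rho> \<omega>' \<Longrightarrow> sum \<omega> E \<le> sum \<omega>' E"
      using that by (auto simp: minimal_parametric_filling_def)
    show "network_with_boundary V M UNIV (kuratowski \<rho> p) (kuratowski_network V E M \<rho> p \<omega>)"
      by (rule boundary[OF fil])
    fix \<Gamma> :: "'v \<Rightarrow> real ^ 'n"
    assume "network_with_boundary V M UNIV (kuratowski \<rho> p) \<Gamma>"
    then have "sum \<omega> E \<le> network_length E linf_dist \<Gamma>"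
      unfolding network_length_def by (intro min filling_of)
    moreover have "network_length E linf_dist (kuratowski_network V E M \<rho> p \<omega>) \<le> sum \<omega> E"
      unfolding network_length_def by (intro sum_mono weight_le fil)
    ultimately show "network_length E linf_dist (kuratowski_network V E M \<rho> p \<omega>)
        \<le> network_length E linf_dist \<Gamma>"
      by linarith
  qed
  show "\<exists>\<omega>. minimal_parametric_filling V E M \<rho> \<omega> \<and> network_isometric V E linf_dist \<Gamma> V E \<omega>"
    if "minimal_parametric_network V E M UNIV linf_dist (kuratowski \<rho> p) \<Gamma>" for \<Gamma>
  proof (intro exI conjI)
    show "network_isometric V E linf_dist \<Gamma> V E (induced_weight linf_dist \<Gamma>)"
      by (rule network_isometric_self) (rule refl)
    have \<Gamma>: "network_with_boundary V M UNIV (kuratowski \<rho> p) \<Gamma>"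
      using that by (auto simp: minimal_parametric_network_def)
    have "sum (induced_weight linf_dist \<Gamma>) E \<le> sum \<omega> E" if fil: "filling V E M \<rho> \<omega>" for \<omega>
    proof -
      have "network_length E linf_dist \<Gamma>
          \<le> network_length E linf_dist (kuratowski_network V E M \<rho> p \<omega>)"
        using \<open>minimal_parametric_network V E M UNIV linf_dist (kuratowski \<rho> p) \<Gamma>\<close> boundary[OF fil]
        by (auto simp: minimal_parametric_network_def)
      also have "\<dots> \<le> sum \<omega> E"
        unfolding network_length_def by (intro sum_mono weight_le fil)
      finally show ?thesis by (simp add: network_length_def)
    qed
    then show "minimal_parametric_filling V E M \<rho> (induced_weight linf_dist \<Gamma>)"
      using filling_of[OF \<Gamma>] unfolding minimal_parametric_filling_def by blast
  qed
qed

end
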